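(* Let $n\geq 1$ be an integer and let $p$ be a prime. Then there exists a finite field with exactly $p^{n}$ elements. *)

theory Defs
  imports "HOL-Algebra.Ring" "HOL-Computational_Algebra.Primes"
begin

end

theory Submission
  imports
    Defs
    "HOL-Algebra.Algebraic_Closure_Type"
    "HOL-Algebra.Multiplicative_Group"
    "HOL-Algebra.Weak_Morphisms"
    "Jordan_Normal_Form.Char_Poly"
begin

text \<open>Put \<open>q = p ^ n\<close>, \<open>m = q - 1\<close> and let \<open>\<zeta>\<close> be a primitive complex \<open>m\<close>-th root of unity. The ring
  \<open>\<int>[\<zeta>]\<close>, written as a quotient of \<open>\<int>[X]\<close>, has a maximal ideal containing \<open>p\<close>; the residue field is
  finite. Frobenius and \<open>\<zeta> ^ q = \<zeta>\<close> give \<open>x ^ q = x\<close> on it, so it has at most \<open>q\<close> elements. Conversely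
  the powers of \<open>\<zeta>\<close> stay distinct in it: for \<open>0 < d < m\<close> the sum of all \<open>\<zeta> ^ (d * k)\<close> with \<open>k < m\<close>
  vanishes, whereas \<open>\<zeta> ^ d = 1\<close> in the residue field would make it \<open>m = -1\<close>.\<close>

section \<open>Maximal ideals above a proper ideal\<close>

text \<open>Zorn's lemma for the ideals that contain \<open>I\<close> and avoid
  \<open>\<one>\<close>. Avoiding \<open>\<one>\<close> passes to unions of chains, and an ideal
  containing \<open>\<one>\<close> is the whole ring.\<close>

lemma (in cring) exists_maximalideal:
  assumes "ideal I R" and "\<one> \<notin> I"
  shows "\<exists>M. maximalideal M R \<and> I \<subseteq> M"
proof -
  define \<A> where "\<A> = {J. ideal J R \<and> I \<subseteq> J \<and> \<one> \<notin> J}"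
  have "\<exists>M\<in>\<A>. \<forall>J\<in>\<A>. M \<subseteq> J \<longrightarrow> J = M"
  proof (rule subset_Zorn_nonempty)
    show "\<A> \<noteq> {}"
      using assms by (auto simp: \<A>_def)
  next
    fix \<C> assume \<C>: "\<C> \<noteq> {}" "subset.chain \<A> \<C>"
    have "subset.chain {J. ideal J R} \<C>"
      using \<C>(2) by (auto simp: subset.chain_def \<A>_def)
    from chain_Union_is_ideal[OF this] \<C> show "\<Union>\<C> \<in> \<A>"
      by (auto simp: \<A>_def subset.chain_def)
  qed
  then obtain M where M: "M \<in> \<A>" and max: "\<And>J. J \<in> \<A> \<Longrightarrow> M \<subseteq> J \<Longrightarrow> J = M"
    by blast
  have "maximalideal M R"
  proof (rule maximalidealI)
    show "ideal M R" "carrier R \<noteq> M"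
      using M by (auto simp: \<A>_def)
    show "J = M \<or> J = carrier R" if "ideal J R" "M \<subseteq> J" "J \<subseteq> carrier R" for J
      using that M max[of J] ideal.one_imp_carrier[of J R] by (auto simp: \<A>_def)
  qed
  with M show ?thesis
    by (auto simp: \<A>_def)
qed

section \<open>Values of integer polynomials at a root of unity\<close>

text \<open>Exponents can be reduced modulo \<open>m\<close>. This serves both integrality and the
  finiteness of the residue ring.\<close>

lemma int_poly_at_root_of_unity:
  fixes \<zeta> :: "'a :: comm_ring_1"
  assumes "\<zeta> ^ m = 1" and "m > 0"
  shows "\<exists>a :: nat \<Rightarrow> int. poly (map_poly of_int f) \<zeta> = (\<Sum>j<m. of_int (a j) * \<zeta> ^ j)"
proof (induction f)
  case 0
  show ?case
    by (rule exI[of _ "\<lambda>_. 0"]) simp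
next
  case (pCons c f)
  then obtain a :: "nat \<Rightarrow> int"
    where a: "poly (map_poly of_int f) \<zeta> = (\<Sum>j<m. of_int (a j) * \<zeta> ^ j)"
    by blast
  obtain l where m: "m = Suc l"
    using assms(2) gr0_implies_Suc by blast
  \<comment> \<open>Multiplication by \<open>\<zeta>\<close> shifts the coefficients cyclically: the
    top one, \<open>a l\<close>, wraps round to exponent 0 and joins the new constant
    \<open>c\<close>.\<close>
  define b where "b j = (case j of 0 \<Rightarrow> c + a l | Suc i \<Rightarrow> a i)" for j
  have "poly (map_poly of_int (pCons c f)) \<zeta> = of_int c + (\<Sum>j<m. of_int (a j) * \<zeta> ^ Suc j)"
    using pCons.hyps by (simp add: map_poly_pCons a sum_distrib_left mult_ac)
  also have "\<dots> = of_int c + of_int (a l) + (\<Sum>j<l. of_int (a j) * \<zeta> ^ Suc j)"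
    using assms(1) by (simp add: m del: power_Suc)
  also have "\<dots> = (\<Sum>j<m. of_int (b j) * \<zeta> ^ j)"
    unfolding m by (subst sum.lessThan_Suc_shift) (simp add: b_def)
  finally show ?case
    by blast
qed

text \<open>Multiplication by \<open>f(\<zeta>)\<close> maps the powers of \<open>\<zeta>\<close> to integer combinations of each other, so
  \<open>f(\<zeta>)\<close> is an eigenvalue of an integer matrix.\<close>
lemma algebraic_int_poly_root_of_unity:
  fixes \<zeta> :: "'a :: field_char_0"
  assumes "\<zeta> ^ m = 1" and "m > 0"
  shows "algebraic_int (poly (map_poly of_int f) \<zeta>)"
proof -
  define c where "c = poly (map_poly of_int f) \<zeta>"
  \<comment> \<open>Evaluating \<open>f * X ^ i\<close> supplies row \<open>i\<close> of the integer
    matrix.\<close>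
  have "\<exists>a :: nat \<Rightarrow> int. c * \<zeta> ^ i = (\<Sum>j<m. of_int (a j) * \<zeta> ^ j)" for i
    using int_poly_at_root_of_unity[OF assms, of "f * Polynomial.monom 1 i"]
    by (simp add: c_def of_int_poly_hom.hom_mult poly_monom)
  then obtain b :: "nat \<Rightarrow> nat \<Rightarrow> int"
    where b: "\<And>i. c * \<zeta> ^ i = (\<Sum>j<m. of_int (b i j) * \<zeta> ^ j)"
    by metis
  define A where "A = mat m m (\<lambda>(i, j). b i j)"
  define v where "v = vec m (\<lambda>j. \<zeta> ^ j)"
  have A: "A \<in> carrier_mat m m"
    by (simp add: A_def)
  have cA: "map_mat (of_int :: int \<Rightarrow> 'a) A \<in> carrier_mat m m"
    using A by simp
  have "map_mat of_int A *\<^sub>v v = c \<cdot>\<^sub>v v"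
    by (rule eq_vecI) (auto simp: A_def v_def b scalar_prod_def lessThan_atLeast0)
  moreover have "v \<noteq> 0\<^sub>v m"
  proof
    assume "v = 0\<^sub>v m"
    then have "v $ 0 = 0\<^sub>v m $ 0"
      by simp
    then show False
      using assms(2) by (simp add: v_def)
  qed
  ultimately have "eigenvalue (map_mat of_int A) c"
    unfolding eigenvalue_def eigenvector_def using A by (auto simp: v_def intro!: exI[of _ v])
  then have "poly (char_poly (map_mat of_int A)) c = 0"
    using eigenvalue_root_char_poly[OF cA] by simp
  then have "poly (map_poly of_int (char_poly A)) c = 0"
    by (simp add: of_int_hom.char_poly_hom[OF A])
  \<comment> \<open>The characteristic polynomial of \<open>A\<close> is monic over the integers, so
    its root \<open>c\<close> is an algebraic integer.\<close>
  moreover have "Polynomial.lead_coeff (char_poly A) = 1"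
    using degree_monic_char_poly[OF A] by simp
  ultimately show ?thesis
    unfolding algebraic_int_altdef_ipoly c_def by blast
qed

section \<open>Frobenius modulo a prime\<close>

text \<open>The inner binomial coefficients of a \<open>p\<close>-th power are divisible by
  \<open>p\<close>; induction on \<open>k\<close> iterates this. Divisibility in a general ring
  covers both integers and integer polynomials.\<close>

lemma frobenius_add_dvd:
  fixes x y :: "'a :: comm_ring_1"
  assumes "Factorial_Ring.prime p"
  shows "of_nat p dvd (x + y) ^ p ^ k - (x ^ p ^ k + y ^ p ^ k)"
proof (induction k)
  case 0
  show ?case by simp
next
  case (Suc k)
  have freshman: "of_nat p dvd (u + v) ^ p - (u ^ p + v ^ p)" for u v :: 'a
  proof -
    obtain l where p: "p = Suc l" and "l > 0"
      using prime_gt_1_nat[OF assms] by (cases p) auto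
    have "(u + v) ^ p = (\<Sum>i\<le>p. of_nat (p choose i) * u ^ i * v ^ (p - i))"
      by (rule binomial_ring)
    also have "\<dots> = v ^ p + u ^ p + (\<Sum>i\<in>{0<..<p}. of_nat (p choose i) * u ^ i * v ^ (p - i))"
    proof -
      have "{..p} = insert 0 (insert p {0<..<p})"
        using p by auto
      then show ?thesis
        using p by (simp add: add.assoc)
    qed
    finally have *: "(u + v) ^ p - (u ^ p + v ^ p) =
        (\<Sum>i\<in>{0<..<p}. of_nat (p choose i) * u ^ i * v ^ (p - i))"
      by simp
    have "of_nat p dvd (of_nat (p choose i) :: 'a)" if "i \<in> {0<..<p}" for i
      using that dvd_choose_prime[of i p] assms by (auto elim!: dvdE)
    then show ?thesis
      unfolding * by (intro dvd_sum dvd_mult2) auto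
  qed
  define a b c where "a = x ^ p ^ k" and "b = y ^ p ^ k" and "c = (x + y) ^ p ^ k"
  \<comment> \<open>Congruences survive \<open>p\<close>-th powers, so the induction hypothesis can
    be raised to the power \<open>p\<close> before the case \<open>k = 1\<close> is applied to
    \<open>a\<close> and \<open>b\<close>.\<close>
  have "c - (a + b) dvd c ^ p - (a + b) ^ p"
    by (simp add: power_diff_sumr2)
  with Suc have "of_nat p dvd c ^ p - (a + b) ^ p"
    unfolding a_def b_def c_def using dvd_trans by blast
  then have "of_nat p dvd (c ^ p - (a + b) ^ p) + ((a + b) ^ p - (a ^ p + b ^ p))"
    using freshman by (rule dvd_add)
  also have "(c ^ p - (a + b) ^ p) + ((a + b) ^ p - (a ^ p + b ^ p)) = c ^ p - (a ^ p + b ^ p)"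
    by (simp add: algebra_simps)
  finally have "of_nat p dvd c ^ p - (a ^ p + b ^ p)" .
  then show ?case
    by (simp add: a_def b_def c_def power_mult [symmetric] mult.commute)
qed

text \<open>Iterated Fermat, from additivity of Frobenius by adding 1 repeatedly. It will handle the
  coefficients of a polynomial.\<close>

lemma fermat_power_dvd:
  fixes c :: int
  assumes "Factorial_Ring.prime p"
  shows "int p dvd c ^ p ^ k - c"
proof -
  have nat: "int p dvd int a ^ p ^ k - int a" for a
  proof (induction a)
    case 0
    show ?case
      using assms by (simp add: prime_gt_0_nat power_0_left)
  next
    case (Suc a)
    have "int p dvd ((int a + 1) ^ p ^ k - (int a ^ p ^ k + 1)) + (int a ^ p ^ k - int a)"
      using frobenius_add_dvd[OF assms, of "int a" 1 k] Suc by (intro dvd_add) auto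
    then show ?case
      by (simp add: algebra_simps)
  qed
  \<comment> \<open>The induction reaches only non-negative integers; a general \<open>c\<close> is
    replaced by its remainder.\<close>
  define r where "r = c mod int p"
  have "r \<ge> 0"
    using assms by (simp add: r_def prime_gt_0_nat)
  have "int p dvd c - r"
    by (simp add: r_def)
  moreover have "c - r dvd c ^ p ^ k - r ^ p ^ k"
    by (simp add: power_diff_sumr2)
  moreover have "int p dvd r ^ p ^ k - r"
    using nat[of "nat r"] \<open>r \<ge> 0\<close> by simp
  ultimately have "int p dvd (c ^ p ^ k - r ^ p ^ k) - (c - r) + (r ^ p ^ k - r)"
    by (meson dvd_add dvd_diff dvd_trans)
  then show ?thesis
    by (simp add: algebra_simps)
qed

text \<open>Modulo \<open>p\<close>, Frobenius is additive and fixes integer coefficients, so it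
  only acts on the variable. At a point with \<open>\<zeta> ^ q = \<zeta>\<close> it therefore acts
  trivially.\<close>

lemma frobenius_pcompose_dvd:
  fixes f :: "int poly"
  assumes "Factorial_Ring.prime p"
  shows "of_nat p dvd f ^ p ^ k - pcompose f (Polynomial.monom 1 (p ^ k))"
proof (induction f)
  case 0
  show ?case
    using assms by (simp add: prime_gt_0_nat power_0_left)
next
  case (pCons c f)
  let ?q = "p ^ k" and ?X = "Polynomial.monom (1::int) 1"
  have 1: "of_nat p dvd ([:c:] + ?X * f) ^ ?q - ([:c:] ^ ?q + (?X * f) ^ ?q)"
    by (rule frobenius_add_dvd[OF assms])
  have 2: "of_nat p dvd [:c:] ^ ?q - [:c:]"
  proof -
    obtain d where "c ^ ?q - c = int p * d"
      using fermat_power_dvd[OF assms, of c k] by (auto simp: dvd_def)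
    then have "[:c:] ^ ?q - [:c:] = of_nat p * [:d:]"
      by (simp add: poly_const_pow of_nat_poly)
    then show ?thesis
      by (metis dvd_triv_left)
  qed
  have 3: "of_nat p dvd ?X ^ ?q * (f ^ ?q - pcompose f (Polynomial.monom 1 ?q))"
    using pCons.IH by (rule dvd_mult)
  have "pCons c f = [:c:] + ?X * f"
    by (simp add: monom_altdef)
  moreover have "pcompose (pCons c f) (Polynomial.monom 1 ?q) =
      [:c:] + ?X ^ ?q * pcompose f (Polynomial.monom 1 ?q)"
    by (simp add: pcompose_pCons monom_power)
  \<comment> \<open>Three errors add up: additivity of Frobenius, Fermat for the constant
    \<open>c\<close>, and the induction hypothesis for the tail \<open>f\<close>.\<close>
  ultimately have "pCons c f ^ ?q - pcompose (pCons c f) (Polynomial.monom 1 ?q) =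
      (([:c:] + ?X * f) ^ ?q - ([:c:] ^ ?q + (?X * f) ^ ?q)) + ([:c:] ^ ?q - [:c:])
      + ?X ^ ?q * (f ^ ?q - pcompose f (Polynomial.monom 1 ?q))"
    by (simp only:) (simp only: algebra_simps power_mult_distrib)
  then show ?case
    using 1 2 3 by (metis dvd_add)
qed

section \<open>Finite fields: counting elements and changing the carrier type\<close>

text \<open>Nonzero elements are roots of \<open>X ^ (q - 1) - 1\<close>, which bounds their number
  by \<open>q - 1\<close>; the powers of \<open>z\<close> attain the bound.\<close>

lemma card_field_of_root_of_unity:
  fixes F (structure)
  assumes "field F" and "finite (carrier F)" and q: "q > 1"
    and frob: "\<And>x. x \<in> carrier F \<Longrightarrow> x [^] q = x"
    and z: "z \<in> carrier F" and inj: "inj_on (\<lambda>i::nat. z [^] i) {..<q - 1}" and "z \<noteq> \<zero>"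
  shows "card (carrier F) = q"
proof -
  interpret field F by fact
  have "carrier F - {\<zero>} \<subseteq> {x \<in> carrier F. x [^] (q - 1) = \<one>}"
  proof safe
    fix x assume x: "x \<in> carrier F" and "x \<noteq> \<zero>"
    have "q = Suc (q - 1)"
      using q by simp
    then have "x [^] (q - 1) \<otimes> x = \<one> \<otimes> x"
      using frob[OF x] x by (metis l_one nat_pow_Suc)
    then show "x [^] (q - 1) = \<one>"
      using x \<open>x \<noteq> \<zero>\<close> m_rcancel by blast
  qed
  then have "card (carrier F - {\<zero>}) \<le> card {x \<in> carrier F. x [^] (q - 1) = \<one>}"
    using assms(2) by (intro card_mono) auto
  also have "\<dots> \<le> q - 1"
    using assms(2) q by (intro num_roots_le_deg) auto
  finally have upper: "card (carrier F - {\<zero>}) \<le> q - 1" .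
  have "(\<lambda>i. z [^] i) ` {..<q - 1} \<subseteq> carrier F - {\<zero>}"
    using Units_pow_closed[of z] z \<open>z \<noteq> \<zero>\<close> by (auto simp: field_Units)
  then have "card ((\<lambda>i. z [^] i) ` {..<q - 1}) \<le> card (carrier F - {\<zero>})"
    using assms(2) by (intro card_mono) auto
  with upper card_image[OF inj] have "card (carrier F - {\<zero>}) = q - 1"
    by simp
  then show ?thesis
    using q assms(2) by (simp add: card_Diff_singleton)
qed

text \<open>The residue field consists of cosets of polynomials; this transports its structure along
  an injection into the naturals.\<close>

lemma (in field) exists_nat_copy:
  assumes "finite (carrier R)"
  shows "\<exists>F :: nat ring. field F \<and> finite (carrier F) \<and> card (carrier F) = card (carrier R)"
proof -
  obtain f :: "'a \<Rightarrow> nat" where f: "inj_on f (carrier R)"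
    using finite_imp_inj_to_nat_seg[OF assms] by blast
  show ?thesis
    using inj_imp_image_ring_is_field[OF f] assms card_image[OF f]
    by (intro exI[of _ "image_ring f R"]) (simp add: image_ring_carrier)
qed

section \<open>The residue ring of integer polynomials at \<open>\<zeta>\<close>\<close>

text \<open>The ideal consists of the \<open>f\<close> with \<open>f(\<zeta>) \<in> p \<int>[\<zeta>]\<close>; it is proper because \<open>1 / p\<close> is not an
  algebraic integer.\<close>
lemma exists_maximalideal_root_of_unity:
  fixes \<zeta> :: complex
  assumes \<zeta>: "\<zeta> ^ m = 1" and m: "m > 0" and p: "p > 1"
  obtains M where "maximalideal M (ring_of_type_algebra :: int poly ring)"
    and "\<And>f. poly (map_poly of_int f) \<zeta> = 0 \<Longrightarrow> f \<in> M"
    and "\<And>f. of_nat p dvd f \<Longrightarrow> f \<in> M"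
proof -
  let ?R = "ring_of_type_algebra :: int poly ring"
  interpret cring ?R
    by (rule cring_from_type_algebra)
  note ring_simps = ring_of_type_algebra_def
  define ev where "ev f = poly (map_poly of_int f) \<zeta>" for f
  have ev_simps: "ev 0 = 0" "ev 1 = 1" "\<And>f g. ev (f + g) = ev f + ev g"
    "\<And>f g. ev (f * g) = ev f * ev g" "\<And>k. ev (of_nat k) = of_nat k" "\<And>f. ev (- f) = - ev f"
    by (simp_all add: ev_def of_int_poly_hom.hom_add of_int_poly_hom.hom_mult
        of_int_poly_hom.hom_uminus of_int_poly_hom.hom_of_nat)
  define I where "I = {f. \<exists>g. ev f = of_nat p * ev g}"
  have "ideal I ?R"
  proof (rule idealI)
    show "ring ?R" ..
    show "subgroup I (add_monoid ?R)"
    proof (rule group.subgroupI)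
      show "group (add_monoid ?R)"
        by (rule a_group)
      show "I \<subseteq> carrier (add_monoid ?R)"
        by (simp add: ring_simps)
      show "I \<noteq> {}"
        using ev_simps(1) by (auto simp: I_def intro!: exI[of _ 0])
      show "inv\<^bsub>add_monoid ?R\<^esub> f \<in> I" if f: "f \<in> I" for f
      proof -
        have "inv\<^bsub>add_monoid ?R\<^esub> f = - f"
          by (rule comm_monoid.comm_inv_char [OF a_comm_monoid]) (simp_all add: ring_simps)
        moreover obtain g where "ev f = of_nat p * ev g"
          using f by (auto simp: I_def)
        then have "ev (- f) = of_nat p * ev (- g)"
          by (simp add: ev_simps)
        ultimately show ?thesis
          unfolding I_def by auto
      qed
      show "f \<otimes>\<^bsub>add_monoid ?R\<^esub> g \<in> I" if fg: "f \<in> I" "g \<in> I" for f g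
      proof -
        obtain f' g' where "ev f = of_nat p * ev f'" "ev g = of_nat p * ev g'"
          using fg by (auto simp: I_def)
        then have "ev (f + g) = of_nat p * ev (f' + g')"
          by (simp add: ev_simps algebra_simps)
        then show ?thesis
          by (auto simp: I_def ring_simps)
      qed
    qed
    have mult: "h * f \<in> I" if f: "f \<in> I" for f h
    proof -
      obtain g where "ev f = of_nat p * ev g"
        using f by (auto simp: I_def)
      then have "ev (h * f) = of_nat p * ev (h * g)"
        by (simp add: ev_simps)
      then show ?thesis
        by (auto simp: I_def)
    qed
    show "h \<otimes>\<^bsub>?R\<^esub> f \<in> I" "f \<otimes>\<^bsub>?R\<^esub> h \<in> I" if "f \<in> I" for f h
      using mult[OF that, of h] by (simp_all add: ring_simps mult.commute)
  qed
  moreover have "\<one>\<^bsub>?R\<^esub> \<notin> I"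
  proof
    assume "\<one>\<^bsub>?R\<^esub> \<in> I"
    then obtain g where "1 = of_nat p * ev g"
      by (auto simp: I_def ring_simps ev_simps)
    then have g: "ev g = 1 / of_nat p"
      using p by (simp add: field_simps)
    have "algebraic_int (ev g)"
      unfolding ev_def using \<zeta> m by (rule algebraic_int_poly_root_of_unity)
    moreover have "ev g \<in> \<rat>"
      by (simp add: g)
    ultimately have "ev g \<in> \<int>"
      by (rule rational_algebraic_int_is_int)
    then obtain k where "(1 :: complex) / of_nat p = of_int k"
      by (auto simp: g elim: Ints_cases)
    then have "(of_int (int p * k) :: complex) = of_int 1"
      using p by (simp add: field_simps)
    then have "int p * k = 1"
      by (simp only: of_int_eq_iff)
    then show False
      using p by (simp add: zmult_eq_1_iff)
  qed
  ultimately obtain M where M: "maximalideal M ?R" "I \<subseteq> M"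
    using exists_maximalideal by blast
  show thesis
  proof (rule that[OF M(1)])
    show "f \<in> M" if "poly (map_poly of_int f) \<zeta> = 0" for f
      using that ev_simps(1) by (auto simp: I_def ev_def intro!: subsetD[OF M(2)] exI[of _ 0])
    show "f \<in> M" if "of_nat p dvd f" for f
      using that by (auto simp: I_def ev_simps elim!: dvdE intro!: subsetD[OF M(2)])
  qed
qed

lemma pow_type_algebra: "x [^]\<^bsub>ring_of_type_algebra\<^esub> (k :: nat) = x ^ k"
  for x :: "'a :: comm_ring_1"
  by (induction k) (simp_all add: nat_pow_def ring_of_type_algebra_def mult.commute)

lemma rcos_eq_iff_type_algebra:
  fixes x y :: "'a :: comm_ring_1"
  assumes "ideal M ring_of_type_algebra"
  shows "M +>\<^bsub>ring_of_type_algebra\<^esub> x = M +>\<^bsub>ring_of_type_algebra\<^esub> y \<longleftrightarrow> x - y \<in> M"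
proof -
  let ?R = "ring_of_type_algebra :: 'a ring"
  interpret cring ?R
    by (rule cring_from_type_algebra)
  have carrier: "u \<in> carrier ?R" for u
    by (simp add: ring_of_type_algebra_def)
  have "x \<ominus>\<^bsub>?R\<^esub> y = x - y"
  proof -
    \<comment> \<open>Adding \<open>y\<close> back identifies the abstract difference with the type
      class one.\<close>
    have "(x \<ominus>\<^bsub>?R\<^esub> y) \<oplus>\<^bsub>?R\<^esub> y = x"
      using carrier by (simp add: a_minus_def a_assoc l_neg)
    then show ?thesis
      by (simp add: ring_of_type_algebra_def algebra_simps)
  qed
  then show ?thesis
    using quotient_eq_iff_same_a_r_cos[OF assms, of x y] carrier by simp
qed

text \<open>Modulo \<open>M\<close>, degrees reduce below \<open>m\<close> by \<open>ker\<close> and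
  coefficients reduce to remainders by \<open>p_in\<close>, leaving at most \<open>p ^ m\<close>
  representatives.\<close>

lemma finite_quotient_root_of_unity:
  fixes \<zeta> :: complex
  assumes "\<zeta> ^ m = 1" and "m > 0" and "p > 0"
    and M: "ideal M (ring_of_type_algebra :: int poly ring)"
    and ker: "\<And>f. poly (map_poly of_int f) \<zeta> = 0 \<Longrightarrow> f \<in> M"
    and p_in: "\<And>f. of_nat p dvd f \<Longrightarrow> f \<in> M"
  shows "finite (carrier (ring_of_type_algebra Quot M))"
proof -
  let ?R = "ring_of_type_algebra :: int poly ring"
  interpret ideal M ?R
    by (rule M)
  define S where "S = (\<lambda>c. \<Sum>j<m. Polynomial.monom (c j) j) ` ({..<m} \<rightarrow>\<^sub>E {0..<int p})"
  have "finite S"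
    unfolding S_def by (intro finite_imageI finite_PiE) auto
  have "\<exists>g\<in>S. M +>\<^bsub>?R\<^esub> f = M +>\<^bsub>?R\<^esub> g" for f
  proof -
    obtain a :: "nat \<Rightarrow> int" where a: "poly (map_poly of_int f) \<zeta> = (\<Sum>j<m. of_int (a j) * \<zeta> ^ j)"
      using int_poly_at_root_of_unity[OF assms(1,2)] by blast
    define h where "h = (\<Sum>j<m. Polynomial.monom (a j) j)"
    define g where "g = (\<Sum>j<m. Polynomial.monom (restrict (\<lambda>j. a j mod int p) {..<m} j) j)"
    have "g \<in> S"
      unfolding S_def g_def using \<open>p > 0\<close>
      by (intro imageI restrict_PiE_iff[THEN iffD2]) auto
    \<comment> \<open>\<open>h\<close> has degree below \<open>m\<close> and the same value at
      \<open>\<zeta>\<close> as \<open>f\<close>.\<close>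
    have "f - h \<in> M"
      by (rule ker)
        (simp add: of_int_poly_hom.hom_minus of_int_poly_hom.hom_sum h_def a poly_sum poly_monom)
    moreover have "h - g \<in> M"
    proof (rule p_in)
      have "h - g = (\<Sum>j<m. Polynomial.monom (a j - a j mod int p) j)"
        by (simp add: h_def g_def sum_subtractf [symmetric] diff_monom)
      also have "\<dots> = (\<Sum>j<m. of_nat p * Polynomial.monom (a j div int p) j)"
        by (intro sum.cong) (simp_all add: of_nat_poly smult_monom minus_mod_eq_mult_div)
      finally show "of_nat p dvd h - g"
        by (simp add: sum_distrib_left [symmetric])
    qed
    ultimately show ?thesis
      using \<open>g \<in> S\<close> rcos_eq_iff_type_algebra[OF M] by metis
  qed
  then have "carrier (?R Quot M) \<subseteq> (\<lambda>g. M +>\<^bsub>?R\<^esub> g) ` S"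
    by (auto simp: FactRing_def A_RCOSETS_def')
  then show ?thesis
    using \<open>finite S\<close> finite_surj by blast
qed

section \<open>The residue field has \<open>p ^ n\<close> elements\<close>

theorem theorem1p17:
  fixes n p :: nat
  assumes "n \<ge> 1" and "Factorial_Ring.prime p"
  shows "\<exists>F :: nat ring. field F \<and> finite (carrier F) \<and> card (carrier F) = p ^ n"
proof -
  let ?R = "ring_of_type_algebra :: int poly ring"
  define m where "m = p ^ n - 1"
  have "p > 1"
    using assms(2) by (rule prime_gt_1_nat)
  then have q: "p ^ n > 1"
    using assms(1) by (intro one_less_power) auto
  then have m: "m > 0" and q_eq: "p ^ n = Suc m"
    by (simp_all add: m_def)
  define \<zeta> where "\<zeta> = cis (2 * pi / m)"
  have \<zeta>_pow: "\<zeta> ^ k = cis (2 * pi * real k / real m)" for k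
    by (simp add: \<zeta>_def DeMoivre mult_ac)
  have \<zeta>: "\<zeta> ^ m = 1"
    using m by (simp add: \<zeta>_pow)
  \<comment> \<open>The parametrisation of the \<open>m\<close>-th roots of unity is injective on
    indices below \<open>m\<close>; compare \<open>d\<close> with 0.\<close>
  have \<zeta>_prim: "\<zeta> ^ d \<noteq> 1" if "0 < d" "d < m" for d
  proof
    assume "\<zeta> ^ d = 1"
    then have "cis (2 * pi * real d / real m) = cis (2 * pi * real 0 / real m)"
      by (simp add: \<zeta>_pow)
    from inj_onD[OF bij_betw_imp_inj_on[OF bij_betw_roots_unity[OF m]] this] that show False
      by simp
  qed
  obtain M where M: "maximalideal M ?R"
    and ker: "\<And>f. poly (map_poly of_int f) \<zeta> = 0 \<Longrightarrow> f \<in> M"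
    and p_in: "\<And>f. of_nat p dvd f \<Longrightarrow> f \<in> M"
    using exists_maximalideal_root_of_unity[OF \<zeta> m \<open>p > 1\<close>] by blast
  interpret maximalideal M ?R
    by (rule M)
  interpret R: cring ?R
    by (rule cring_from_type_algebra)
  interpret K: field "?R Quot M"
    by (rule quotient_is_field) (rule R.cring_axioms)
  define cls where "cls f = M +>\<^bsub>?R\<^esub> f" for f
  have cls_eq: "cls f = cls g \<longleftrightarrow> f - g \<in> M" for f g
    unfolding cls_def by (rule rcos_eq_iff_type_algebra[OF is_ideal])
  have carrier: "carrier (?R Quot M) = range cls"
    by (auto simp: FactRing_def A_RCOSETS_def' cls_def ring_of_type_algebra_def)
  interpret cls: ring_hom_ring ?R "?R Quot M" cls
    unfolding cls_def by (rule rcos_ring_hom_ring)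
  have cls_simps: "cls 0 = \<zero>\<^bsub>?R Quot M\<^esub>" "cls 1 = \<one>\<^bsub>?R Quot M\<^esub>"
    "\<And>f g. cls (f + g) = cls f \<oplus>\<^bsub>?R Quot M\<^esub> cls g"
    using cls.hom_zero cls.hom_one cls.hom_add by (simp_all add: ring_of_type_algebra_def)
  have cls_pow: "cls f [^]\<^bsub>?R Quot M\<^esub> k = cls (f ^ k)" for f and k :: nat
    using cls.hom_nat_pow[of f k]
    by (simp add: pow_type_algebra) (simp add: ring_of_type_algebra_def)
  have cls_closed: "cls f \<in> carrier (?R Quot M)" for f
    by (simp add: carrier)
  have fin: "finite (carrier (?R Quot M))"
    using \<zeta> m prime_gt_0_nat[OF assms(2)] is_ideal ker p_in
    by (rule finite_quotient_root_of_unity)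
  have frob: "x [^]\<^bsub>?R Quot M\<^esub> (p ^ n) = x" if x: "x \<in> carrier (?R Quot M)" for x
  proof -
    obtain f where f: "x = cls f"
      using x unfolding carrier by (rule rangeE)
    let ?g = "pcompose f (Polynomial.monom 1 (p ^ n))"
    \<comment> \<open>First \<open>p\<close> is killed, turning \<open>f(X) ^ q\<close> into
      \<open>f(X ^ q)\<close>; then \<open>\<zeta> ^ q = \<zeta>\<close> identifies this with
      \<open>f\<close>.\<close>
    have "cls (f ^ (p ^ n)) = cls ?g"
      unfolding cls_eq by (rule p_in) (rule frobenius_pcompose_dvd[OF assms(2)])
    also have "\<dots> = cls f"
      unfolding cls_eq
    proof (rule ker)
      have "\<zeta> ^ p ^ n = \<zeta>"
        by (simp add: q_eq \<zeta>)
      then have "poly (map_poly of_int ?g) \<zeta> = poly (map_poly of_int f) \<zeta>"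
        by (simp add: of_int_hom.map_poly_pcompose poly_pcompose poly_monom)
      then show "poly (map_poly of_int (?g - f)) \<zeta> = 0"
        by (simp add: of_int_poly_hom.hom_minus)
    qed
    finally show ?thesis
      by (simp add: f cls_pow)
  qed
  \<comment> \<open>The class of \<open>X\<close> is the image of \<open>\<zeta>\<close> in the
    residue field.\<close>
  define \<xi> where "\<xi> = cls (Polynomial.monom 1 1)"
  have \<xi>: "\<xi> \<in> carrier (?R Quot M)"
    unfolding \<xi>_def by (rule cls_closed)
  have \<xi>_pow: "\<xi> [^]\<^bsub>?R Quot M\<^esub> i = cls (Polynomial.monom 1 i)" for i :: nat
    by (simp add: \<xi>_def cls_pow monom_power)
  have "\<xi> [^]\<^bsub>?R Quot M\<^esub> m = \<one>\<^bsub>?R Quot M\<^esub>"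
    unfolding \<xi>_pow cls_simps(2) [symmetric] cls_eq
    by (rule ker) (simp add: of_int_poly_hom.hom_minus poly_monom \<zeta>)
  then have \<xi>_nz: "\<xi> \<noteq> \<zero>\<^bsub>?R Quot M\<^esub>"
    using K.nat_pow_zero[of m] m by auto
  have \<xi>_prim: "\<xi> [^]\<^bsub>?R Quot M\<^esub> d \<noteq> \<one>\<^bsub>?R Quot M\<^esub>" if d: "0 < d" "d < m" for d
  proof
    assume "\<xi> [^]\<^bsub>?R Quot M\<^esub> d = \<one>\<^bsub>?R Quot M\<^esub>"
    then have pow: "cls (Polynomial.monom 1 d ^ k) = cls 1" for k
      by (simp add: \<xi>_pow cls_simps flip: cls_pow)
    \<comment> \<open>With general length \<open>l\<close>, induction shows that \<open>s l\<close>
      has class \<open>l\<close> if \<open>\<xi> ^ d = 1\<close>; for \<open>l = m\<close> the sum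
      vanishes at \<open>\<zeta>\<close>.\<close>
    define s where "s l = (\<Sum>k<l. Polynomial.monom (1::int) d ^ k)" for l :: nat
    have s_cls: "cls (s l) = cls (of_nat l)" for l
      by (induction l) (simp_all add: s_def cls_simps(3) pow K.a_comm cls_closed)
    have "(\<Sum>k<m. (\<zeta> ^ d) ^ k) = ((\<zeta> ^ d) ^ m - 1) / (\<zeta> ^ d - 1)"
      by (rule geometric_sum) (rule \<zeta>_prim[OF d])
    also have "(\<zeta> ^ d) ^ m = 1"
      using \<zeta> by (metis power_mult mult.commute power_one)
    finally have "cls (s m) = cls 0"
      unfolding cls_eq
      by (intro ker)
        (simp add: s_def of_int_poly_hom.hom_sum of_int_poly_hom.hom_power poly_sum poly_monom)
    then have "cls (of_nat m) = \<zero>\<^bsub>?R Quot M\<^esub>"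
      by (simp add: s_cls cls_simps)
    \<comment> \<open>Since \<open>m + 1 = p ^ n\<close> is a multiple of \<open>p\<close>, the
      classes of both \<open>m\<close> and \<open>m + 1\<close> vanish, forcing
      \<open>1 = 0\<close>.\<close>
    moreover have "cls (of_nat m + 1) = cls 0"
    proof -
      have "of_nat m + 1 = (of_nat p ^ n :: int poly)"
        using q_eq by (metis of_nat_Suc of_nat_power add.commute)
      then show ?thesis
        unfolding cls_eq using assms(1) by (intro p_in) simp
    qed
    ultimately show False
      by (simp add: cls_simps)
  qed
  have "inj_on (\<lambda>i. \<xi> [^]\<^bsub>?R Quot M\<^esub> i) {..<p ^ n - 1}"
  proof (rule linorder_inj_onI')
    fix i j assume "i \<in> {..<p ^ n - 1}" "j \<in> {..<p ^ n - 1}" "i < j"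
    then have d: "0 < j - i" "j - i < m"
      by (auto simp: m_def)
    \<comment> \<open>Equal powers with exponents \<open>i < j\<close> would cancel to
      \<open>\<xi> ^ (j - i) = 1\<close>, where \<open>0 < j - i < m\<close>.\<close>
    have "\<xi> [^]\<^bsub>?R Quot M\<^esub> i \<in> Units (?R Quot M)"
      using \<xi> \<xi>_nz by (intro K.Units_pow_closed) (simp add: K.field_Units)
    moreover have "\<xi> [^]\<^bsub>?R Quot M\<^esub> j = \<xi> [^]\<^bsub>?R Quot M\<^esub> i \<otimes>\<^bsub>?R Quot M\<^esub> \<xi> [^]\<^bsub>?R Quot M\<^esub> (j - i)"
      using \<xi> \<open>i < j\<close> by (simp add: K.nat_pow_mult)
    ultimately show "\<xi> [^]\<^bsub>?R Quot M\<^esub> i \<noteq> \<xi> [^]\<^bsub>?R Quot M\<^esub> j"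
      using \<xi>_prim[OF d] \<xi> K.Units_l_cancel[of "\<xi> [^]\<^bsub>?R Quot M\<^esub> i" "\<xi> [^]\<^bsub>?R Quot M\<^esub> (j - i)" "\<one>\<^bsub>?R Quot M\<^esub>"]
      by auto
  qed
  then have "card (carrier (?R Quot M)) = p ^ n"
    using card_field_of_root_of_unity[OF K.field_axioms fin q frob \<xi> _ \<xi>_nz] by simp
  then show ?thesis
    using K.exists_nat_copy[OF fin] by simp
qed

end
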